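(* Let $\mathcal A$ and $\mathcal B$ be labeled combinatorial classes with $\mathcal A=\mathrm{SEQ}(\mathcal B)$, and assume that $\mathcal A$ is gargantuan. Let $a\in\mathcal A$ be a uniformly random object of size $n$. Then for every positive integer $m$, \[ \mathbb P(a\text{ has }m\ \mathrm{SEQ}\text{-irreducible components})\approx\sum_{k\ge0} d_{k,m}\binom{n}{k}\frac{\mathfrak a_{n-k}}{\mathfrak a_n}, \qquad d_{k,m}=m\Big(\mathfrak b_k^{(m-1)}-2\mathfrak b_k^{(m)}+\mathfrak b_k^{(m+1)}\Big). \] In particular, for $m=1$, \[ \mathbb P(a\text{ is }\mathrm{SEQ}\text{-irreducible})\approx 1-\sum_{k\ge1}\Big(2\mathfrak b_k-\mathfrak b_k^{(2)}\Big)\binom{n}{k}\frac{\mathfrak a_{n-k}}{\mathfrak a_n}. \]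
   Context: A labeled combinatorial class is a collection of objects, each having a finite size $n$ and atoms labeled bijectively by $[n]=\{1,\dots,n\}$, stable under relabeling, with finitely many objects $\mathfrak a_n$ of each size $n$; its exponential generating function is $A(z)=\sum_n\mathfrak a_n z^n/n!$. For a labeled class $\mathcal B$ with $\mathfrak b_0=0$, $\mathcal B^m=\mathrm{SEQ}_m(\mathcal B)$ is the labeled product of $m$ copies of $\mathcal B$ (ordered $m$-tuples of $\mathcal B$-objects relabeled in all order-consistent ways), with EGF $B(z)^m$, and $\mathrm{SEQ}(\mathcal B)=\sum_{m\ge0}\mathcal B^m$, with EGF $1/(1-B(z))$. If $\mathcal A=\mathrm{SEQ}(\mathcal B)$, an object of $\mathcal A$ lying in $\mathcal B^m$ is said to have $m$ $\mathrm{SEQ}$-irreducible components; for $m=1$ it is called $\mathrm{SEQ}$-irreducible. $\mathfrak b_n^{(m)}$ denotes the number of objects of size $n$ in $\mathcal B^m$ (so $\mathfrak b_n^{(1)}=\mathfrak b_n$), with the convention $\mathfrak b_0^{(0)}=1$, $\mathfrak b_n^{(0)}=0$ for $n>0$. A random object of size $n$ is uniform among the $\mathfrak a_n$ objects of size $n$; probabilities are sequences in $n$ (over $n$ with $\mathfrak a_n>0$). A sequence $(a_n)$ is gargantuan if $a_{n-1}/a_n\to0$ and, for every positive integer $r$, $\sum_{k=r}^{n-r}|a_ka_{n-k}|=O(a_{n-r})$ as $n\to\infty$. A labeled class is gargantuan if $(\mathfrak a_n/n!)$ is gargantuan. Notation: $x_n\approx\sum_{k\ge m}c_kf_k(n)$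 means that for every $r\ge m$, $x_n=\sum_{k=m}^r c_kf_k(n)+O(f_{r+1}(n))$, and $f_{k+1}(n)=o(f_k(n))$ for every $k\ge m$ (the constants $c_k$ may be zero). *)

theory Defs
  imports "HOL-Probability.Probability" "HOL-Library.Landau_Symbols"
    "HOL-Combinatorics.Permutations"
begin

section \<open>Labeled combinatorial classes\<close>

text \<open>
  An object of size \<open>n\<close> carries atoms labeled bijectively by \<open>{1..n}\<close>. The labeling enters
  through the relabeling action: \<open>relabel C \<sigma> a\<close> is the object obtained from \<open>a\<close> when the
  label \<open>i\<close> is replaced by \<open>\<sigma> i\<close>, for \<open>\<sigma>\<close> a permutation of \<open>{1..n}\<close>.
\<close>

record 'a lclass =
  objs :: "'a set"
  osize :: "'a \<Rightarrow> nat"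
  relabel :: "(nat \<Rightarrow> nat) \<Rightarrow> 'a \<Rightarrow> 'a"

definition objs_of_size :: "'a lclass \<Rightarrow> nat \<Rightarrow> 'a set" where
  "objs_of_size C n = {a \<in> objs C. osize C a = n}"

definition num_objs :: "'a lclass \<Rightarrow> nat \<Rightarrow> nat" where
  "num_objs C n = card (objs_of_size C n)"

locale labeled_class =
  fixes C :: "'a lclass"
  assumes finite_objs_of_size: "finite (objs_of_size C n)"
    and relabel_closed:
      "a \<in> objs C \<Longrightarrow> \<sigma> permutes {1..osize C a} \<Longrightarrow> relabel C \<sigma> a \<in> objs C"
    and osize_relabel:
      "a \<in> objs C \<Longrightarrow> \<sigma> permutes {1..osize C a} \<Longrightarrow> osize C (relabel C \<sigma> a) = osize C a"
    and relabel_id: "a \<in> objs C \<Longrightarrow> relabel C id a = a"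
    and relabel_comp:
      "a \<in> objs C \<Longrightarrow> \<sigma> permutes {1..osize C a} \<Longrightarrow> \<tau> permutes {1..osize C a}
        \<Longrightarrow> relabel C (\<sigma> \<circ> \<tau>) a = relabel C \<sigma> (relabel C \<tau> a)"

text \<open>Equality of classes, as in \<open>A = SEQ B\<close>, is understood up to this notion of isomorphism.\<close>

definition lclass_iso :: "('a \<Rightarrow> 'b) \<Rightarrow> 'a lclass \<Rightarrow> 'b lclass \<Rightarrow> bool" where
  "lclass_iso \<phi> C D \<longleftrightarrow>
     bij_betw \<phi> (objs C) (objs D) \<and>
     (\<forall>a\<in>objs C. osize D (\<phi> a) = osize C a) \<and>
     (\<forall>a\<in>objs C. \<forall>\<sigma>. \<sigma> permutes {1..osize C a} \<longrightarrow> \<phi> (relabel C \<sigma> a) = relabel D \<sigma> (\<phi> a))"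

section \<open>Labeled products and sequences\<close>

text \<open>
  A pair \<open>(S, b)\<close> with \<open>card S = osize B b\<close> stands for the object \<open>b\<close> after the order-consistent
  relabeling of its atoms by the elements of \<open>S\<close>: the atom with label \<open>i\<close> receives the \<open>i\<close>-th
  smallest element of \<open>S\<close>. An object of \<open>B\<^sup>m\<close> is a list of \<open>m\<close> such pairs whose label sets
  partition \<open>{1..n}\<close>, where \<open>n\<close> is the total size.
\<close>

definition seq_size :: "'b lclass \<Rightarrow> (nat set \<times> 'b) list \<Rightarrow> nat" where
  "seq_size B xs = (\<Sum>(S, b)\<leftarrow>xs. osize B b)"

definition seq_objs :: "'b lclass \<Rightarrow> (nat set \<times> 'b) list set" where
  "seq_objs B = {xs.
     (\<forall>(S, b)\<in>set xs. b \<in> objs B \<and> finite S \<and> card S = osize B b) \<and>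
     (\<forall>i<length xs. \<forall>j<length xs. i \<noteq> j \<longrightarrow> fst (xs ! i) \<inter> fst (xs ! j) = {}) \<and>
     (\<Union>(S, b)\<in>set xs. S) = {1..seq_size B xs}}"

text \<open>The order-preserving bijection from a finite set \<open>S\<close> onto \<open>{1..card S}\<close>.\<close>

definition label_rank :: "nat set \<Rightarrow> nat \<Rightarrow> nat" where
  "label_rank S x = card {y \<in> S. y \<le> x}"

text \<open>
  Applying \<open>\<sigma>\<close> to the labels in \<open>S\<close> turns them into \<open>\<sigma> ` S\<close>; on the ranks of the labels,
  this acts as the following permutation of \<open>{1..card S}\<close>.
\<close>

definition rank_perm :: "(nat \<Rightarrow> nat) \<Rightarrow> nat set \<Rightarrow> nat \<Rightarrow> nat" where
  "rank_perm \<sigma> S i =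
     (if i \<in> {1..card S} then label_rank (\<sigma> ` S) (\<sigma> (inv_into S (label_rank S) i)) else i)"

definition seq_relabel ::
    "'b lclass \<Rightarrow> (nat \<Rightarrow> nat) \<Rightarrow> (nat set \<times> 'b) list \<Rightarrow> (nat set \<times> 'b) list" where
  "seq_relabel B \<sigma> = map (\<lambda>(S, b). (\<sigma> ` S, relabel B (rank_perm \<sigma> S) b))"

definition SEQ_pow :: "nat \<Rightarrow> 'b lclass \<Rightarrow> (nat set \<times> 'b) list lclass" where
  "SEQ_pow m B = \<lparr>objs = {xs \<in> seq_objs B. length xs = m},
     osize = seq_size B, relabel = seq_relabel B\<rparr>"

definition SEQ :: "'b lclass \<Rightarrow> (nat set \<times> 'b) list lclass" where
  "SEQ B = \<lparr>objs = (\<Union>m. objs (SEQ_pow m B)),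
     osize = seq_size B, relabel = seq_relabel B\<rparr>"

lemma objs_SEQ: "objs (SEQ B) = seq_objs B"
  by (auto simp: SEQ_def SEQ_pow_def)

lemma rank_bij:
  assumes "finite S" shows "bij_betw (label_rank S) S {1..card S}"
proof -
  have lt: "label_rank S x < label_rank S y" if "x \<in> S" "y \<in> S" "x < y" for x y
  proof -
    have "{z \<in> S. z \<le> x} \<subseteq> {z \<in> S. z \<le> y}" "y \<in> {z \<in> S. z \<le> y}" "y \<notin> {z \<in> S. z \<le> x}"
      using that by auto
    then have "{z \<in> S. z \<le> x} \<subset> {z \<in> S. z \<le> y}" by blast
    then show ?thesis unfolding label_rank_def using assms by (intro psubset_card_mono) auto
  qed
  have inj: "inj_on (label_rank S) S"
    by (rule linorder_inj_onI) (use lt in fastforce)+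
  have sub: "label_rank S ` S \<subseteq> {1..card S}"
  proof
    fix i assume "i \<in> label_rank S ` S"
    then obtain x where x: "x \<in> S" "i = card {y \<in> S. y \<le> x}" by (auto simp: label_rank_def)
    have "card {y \<in> S. y \<le> x} \<le> card S" using assms by (intro card_mono) auto
    moreover have "card {y \<in> S. y \<le> x} \<noteq> 0" using x assms by auto
    ultimately show "i \<in> {1..card S}" unfolding x(2) atLeastAtMost_iff by linarith
  qed
  have "label_rank S ` S = {1..card S}"
    by (rule card_subset_eq) (use sub inj in \<open>auto simp: card_image\<close>)
  with inj show ?thesis by (simp add: bij_betw_def)
qed

lemma rank_perm_rank:
  assumes "finite S" "x \<in> S"
  shows "rank_perm \<sigma> S (label_rank S x) = label_rank (\<sigma> ` S) (\<sigma> x)"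
  using rank_bij[OF assms(1)] assms(2)
  by (auto simp: rank_perm_def bij_betw_def inv_into_f_f)

lemma rank_perm_permutes:
  assumes "finite S" "inj \<sigma>"
  shows "rank_perm \<sigma> S permutes {1..card S}"
proof (rule bij_imp_permutes)
  have c: "card (\<sigma> ` S) = card S" using assms by (simp add: card_image inj_on_subset)
  have "bij_betw (label_rank (\<sigma> ` S) \<circ> \<sigma> \<circ> inv_into S (label_rank S)) {1..card S} {1..card S}"
    using bij_betw_inv_into[OF rank_bij[OF assms(1)]] rank_bij[of "\<sigma> ` S"] assms c
    by (metis (no_types, lifting) bij_betw_trans finite_imageI inj_on_imp_bij_betw
        inj_on_subset subset_UNIV)
  then show "bij_betw (rank_perm \<sigma> S) {1..card S} {1..card S}"
    by (rule bij_betw_cong[THEN iffD1, rotated]) (simp add: rank_perm_def)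
qed (auto simp: rank_perm_def)

lemma rank_perm_id:
  assumes "finite S" shows "rank_perm id S = id"
proof
  fix i show "rank_perm id S i = id i"
    using bij_betw_inv_into_right[OF rank_bij[OF assms], of i] by (auto simp: rank_perm_def)
qed

lemma rank_perm_comp:
  assumes "finite S" "inj \<tau>"
  shows "rank_perm (\<sigma> \<circ> \<tau>) S = rank_perm \<sigma> (\<tau> ` S) \<circ> rank_perm \<tau> S"
proof
  fix i
  have c: "card (\<tau> ` S) = card S" using assms by (simp add: card_image inj_on_subset)
  show "rank_perm (\<sigma> \<circ> \<tau>) S i = (rank_perm \<sigma> (\<tau> ` S) \<circ> rank_perm \<tau> S) i"
  proof (cases "i \<in> {1..card S}")
    case True
    then obtain x where "x \<in> S" "i = label_rank S x"
      using rank_bij[OF assms(1)] unfolding bij_betw_def by (metis imageE)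
    then show ?thesis using assms by (simp add: rank_perm_rank image_comp)
  qed (auto simp: rank_perm_def c)
qed

theorem labeled_class_SEQ:
  assumes B: "labeled_class B" and B0: "num_objs B 0 = 0"
  shows "labeled_class (SEQ B)"
proof -
  interpret B: labeled_class B by (rule B)
  have B0': "osize B b \<noteq> 0" if "b \<in> objs B" for b
    using B0 B.finite_objs_of_size[of 0] that by (auto simp: num_objs_def objs_of_size_def)
  have elt: "b \<in> objs B" "finite S" "card S = osize B b" if "xs \<in> seq_objs B" "(S, b) \<in> set xs"
    for xs S b using that by (auto simp: seq_objs_def)
  have size: "seq_size B (seq_relabel B \<sigma> xs) = seq_size B xs"
    if "xs \<in> seq_objs B" "inj \<sigma>" for xs \<sigma>
  proof -
    have "osize B (relabel B (rank_perm \<sigma> S) b) = osize B b" if mem: "(S, b) \<in> set xs" for S b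
      using elt[OF \<open>xs \<in> seq_objs B\<close> mem] rank_perm_permutes[of S \<sigma>] \<open>inj \<sigma>\<close>
      by (intro B.osize_relabel) auto
    then show ?thesis
      unfolding seq_size_def seq_relabel_def map_map
      by (intro arg_cong[where f = sum_list] map_cong) auto
  qed
  show ?thesis
  proof (unfold_locales, goal_cases)
    case (1 n)
    define X where "X = Pow {1..n} \<times> (\<Union>k\<le>n. objs_of_size B k)"
    have X: "finite X" unfolding X_def using B.finite_objs_of_size by auto
    have "objs_of_size (SEQ B) n \<subseteq> {xs. set xs \<subseteq> X \<and> length xs \<le> n}"
    proof
      fix xs assume "xs \<in> objs_of_size (SEQ B) n"
      then have xs: "xs \<in> seq_objs B" "seq_size B xs = n"
        by (auto simp: objs_of_size_def objs_SEQ) (simp add: SEQ_def)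
      have "(S, b) \<in> X" if "(S, b) \<in> set xs" for S b
      proof -
        have S: "S \<subseteq> {1..n}" using xs that by (fastforce simp: seq_objs_def)
        then have "card S \<le> n" using card_mono[of "{1..n}" S] by simp
        with S elt[OF xs(1) that] show ?thesis by (auto simp: X_def objs_of_size_def)
      qed
      moreover have "(\<Sum>x\<leftarrow>xs. 1) \<le> seq_size B xs"
        unfolding seq_size_def
        by (rule sum_list_mono) (use elt[OF xs(1)] B0' in \<open>fastforce simp: Suc_le_eq\<close>)
      then have "length xs \<le> n" using xs by (simp add: sum_list_triv)
      ultimately show "xs \<in> {xs. set xs \<subseteq> X \<and> length xs \<le> n}" by auto
    qed
    then show ?case using finite_lists_length_le[OF X] finite_subset by blast
  next
    case (2 xs \<sigma>)
    then have xs: "xs \<in> seq_objs B" and \<sigma>: "\<sigma> permutes {1..seq_size B xs}"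
      by (simp_all add: objs_SEQ) (simp add: SEQ_def)
    have inj: "inj \<sigma>" using \<sigma> by (rule permutes_inj)
    have "(\<Union>(S, b)\<in>set (seq_relabel B \<sigma> xs). S) = \<sigma> ` (\<Union>(S, b)\<in>set xs. S)"
      by (auto simp: seq_relabel_def)
    also have "\<dots> = {1..seq_size B xs}"
      using xs \<sigma> by (simp add: seq_objs_def permutes_image)
    finally have un: "(\<Union>(S, b)\<in>set (seq_relabel B \<sigma> xs). S) =
        {1..seq_size B (seq_relabel B \<sigma> xs)}" using size[OF xs inj] by simp
    have nth: "fst (seq_relabel B \<sigma> xs ! i) = \<sigma> ` fst (xs ! i)" if "i < length xs" for i
      using that by (simp add: seq_relabel_def case_prod_unfold)
    have len: "length (seq_relabel B \<sigma> xs) = length xs" by (simp add: seq_relabel_def)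
    have dis: "\<forall>i<length xs. \<forall>j<length xs. i \<noteq> j \<longrightarrow>
        fst (seq_relabel B \<sigma> xs ! i) \<inter> fst (seq_relabel B \<sigma> xs ! j) = {}"
      using xs by (auto simp: nth seq_objs_def inj_eq[OF inj]) blast
    have "b' \<in> objs B \<and> finite S' \<and> card S' = osize B b'"
      if mem: "(S', b') \<in> set (seq_relabel B \<sigma> xs)" for S' b'
    proof -
      obtain S b where Sb: "(S, b) \<in> set xs" "S' = \<sigma> ` S" "b' = relabel B (rank_perm \<sigma> S) b"
        using mem by (auto simp: seq_relabel_def)
      note e = elt[OF xs Sb(1)]
      have p: "rank_perm \<sigma> S permutes {1..osize B b}"
        using rank_perm_permutes[OF e(2) inj] e(3) by simp
      show ?thesis using Sb e B.relabel_closed[OF e(1) p] B.osize_relabel[OF e(1) p] inj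
        by (simp add: card_image inj_on_subset)
    qed
    then have "seq_relabel B \<sigma> xs \<in> seq_objs B"
      using un dis len unfolding seq_objs_def by auto
    then show ?case by (simp add: objs_SEQ) (simp add: SEQ_def)
  next
    case (3 xs \<sigma>)
    then have "xs \<in> seq_objs B" "\<sigma> permutes {1..seq_size B xs}"
      by (simp_all add: objs_SEQ) (simp add: SEQ_def)
    then show ?case using size[OF _ permutes_inj] by (simp add: SEQ_def)
  next
    case (4 xs)
    then have xs: "xs \<in> seq_objs B" by (simp add: objs_SEQ)
    have "seq_relabel B id xs = xs"
      unfolding seq_relabel_def
      by (rule map_idI) (use elt[OF xs] in \<open>auto simp: rank_perm_id B.relabel_id\<close>)
    then show ?case by (simp add: SEQ_def)
  next
    case (5 xs \<sigma> \<tau>)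
    then have xs: "xs \<in> seq_objs B" and "\<sigma> permutes {1..seq_size B xs}"
      "\<tau> permutes {1..seq_size B xs}"
      by (simp_all add: objs_SEQ) (simp_all add: SEQ_def)
    then have inj: "inj \<sigma>" "inj \<tau>" using permutes_inj by auto
    have "relabel B (rank_perm (\<sigma> \<circ> \<tau>) S) b =
        relabel B (rank_perm \<sigma> (\<tau> ` S)) (relabel B (rank_perm \<tau> S) b)"
      if "(S, b) \<in> set xs" for S b
    proof -
      note e = elt[OF xs that]
      have c: "card (\<tau> ` S) = card S" using inj by (simp add: card_image inj_on_subset)
      show ?thesis
        unfolding rank_perm_comp[OF e(2) inj(2)]
        using B.relabel_comp[OF e(1)] rank_perm_permutes[OF e(2) inj(2)]
          rank_perm_permutes[of "\<tau> ` S" \<sigma>] e inj c by simp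
    qed
    then have "seq_relabel B (\<sigma> \<circ> \<tau>) xs = seq_relabel B \<sigma> (seq_relabel B \<tau> xs)"
      by (auto simp: seq_relabel_def image_comp)
    then show ?case by (simp add: SEQ_def)
  qed
qed

text \<open>
  For a class \<open>A\<close> identified with \<open>SEQ B\<close> through \<open>\<phi>\<close>: the object \<open>a\<close> lies in \<open>B\<^sup>m\<close>.
\<close>

definition has_SEQ_components :: "('a \<Rightarrow> (nat set \<times> 'b) list) \<Rightarrow> 'b lclass \<Rightarrow> nat \<Rightarrow> 'a \<Rightarrow> bool" where
  "has_SEQ_components \<phi> B m a \<longleftrightarrow> \<phi> a \<in> objs (SEQ_pow m B)"

definition SEQ_irreducible :: "('a \<Rightarrow> (nat set \<times> 'b) list) \<Rightarrow> 'b lclass \<Rightarrow> 'a \<Rightarrow> bool" where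
  "SEQ_irreducible \<phi> B a \<longleftrightarrow> has_SEQ_components \<phi> B 1 a"

section \<open>Random objects and asymptotics\<close>

text \<open>Meaningful only for \<open>n\<close> with \<open>num_objs C n > 0\<close>: the uniform distribution on
  the empty set is unspecified.\<close>

definition prob_of_size :: "'a lclass \<Rightarrow> nat \<Rightarrow> ('a \<Rightarrow> bool) \<Rightarrow> real" where
  "prob_of_size C n P = measure_pmf.prob (pmf_of_set (objs_of_size C n)) {a. P a}"

text \<open>
  The first condition is implicit in \<open>a (n - 1) / a n \<rightarrow> 0\<close>; it is spelled out because of
  \<open>x / 0 = 0\<close>.
\<close>

definition gargantuan :: "(nat \<Rightarrow> real) \<Rightarrow> bool" where
  "gargantuan a \<longleftrightarrow>
     (\<forall>\<^sub>F n in sequentially. a n \<noteq> 0) \<and>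
     (\<lambda>n. a (n - 1) / a n) \<longlonglongrightarrow> 0 \<and>
     (\<forall>r\<ge>1. (\<lambda>n. \<Sum>k=r..n-r. \<bar>a k * a (n - k)\<bar>) \<in> O(\<lambda>n. a (n - r)))"

definition gargantuan_class :: "'a lclass \<Rightarrow> bool" where
  "gargantuan_class C \<longleftrightarrow> gargantuan (\<lambda>n. real (num_objs C n) / fact n)"

text \<open>The relation \<open>x n \<approx> (\<Sum>k\<ge>m. c k * f k n)\<close>.\<close>

definition asymp_expansion ::
    "(nat \<Rightarrow> real) \<Rightarrow> nat \<Rightarrow> (nat \<Rightarrow> real) \<Rightarrow> (nat \<Rightarrow> nat \<Rightarrow> real) \<Rightarrow> bool" where
  "asymp_expansion x m c f \<longleftrightarrow>
     (\<forall>r\<ge>m. (\<lambda>n. x n - (\<Sum>k=m..r. c k * f k n)) \<in> O(f (r + 1))) \<and>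
     (\<forall>k\<ge>m. f (k + 1) \<in> o(f k))"

end

theory Submission
  imports Defs
begin

text \<open>
  Let \<open>a\<^sub>n\<close> be the coefficients of \<open>A(z) = 1 / (1 - B(z))\<close>. If two series have coefficients bounded by
  \<open>a\<^sub>n\<close>, then by gargantuanness only the terms near the two ends of their Cauchy product matter;
  hence passing from \<open>X\<close> to the series \<open>C\<close> with \<open>x\<^sub>n \<approx> \<Sum> c\<^sub>k a\<^sub>n\<^sub>-\<^sub>k\<close> is a derivation.
  It maps \<open>A\<close> to \<open>1\<close>, therefore \<open>B\<close> to \<open>(1 - B)\<^sup>2\<close> and \<open>B\<^sup>m\<close> to \<open>m B\<^sup>m\<^sup>-\<^sup>1 (1 - B)\<^sup>2\<close>, whose coefficients
  are \<open>d\<^sub>k\<^sub>,\<^sub>m / k!\<close>. The bound on the coefficients of \<open>B\<^sup>m\<close> comes for free, since \<open>A\<close> is the sum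
  of all \<open>B\<^sup>m\<close>.
\<close>

unbundle no vec_syntax
unbundle Formal_Power_Series.fps_syntax

section \<open>Expansions along a gargantuan sequence\<close>

text \<open>One fixed order \<open>R\<close> of the expansion, so that orders can be treated by
  induction. Keeping the coefficients in a power series turns convolutions of expansions into
  products.\<close>

definition expands_at :: "(nat \<Rightarrow> real) \<Rightarrow> nat \<Rightarrow> real fps \<Rightarrow> real fps \<Rightarrow> bool" where
  "expands_at a R X C \<longleftrightarrow> (\<lambda>n. X $ n - (\<Sum>k<R. C $ k * a (n - k))) \<in> O(\<lambda>n. a (n - R))"

lemma bigo_shift_nat:
  fixes f g :: "nat \<Rightarrow> real"
  assumes "f \<in> O(g)"
  shows "(\<lambda>n. f (n - k)) \<in> O(\<lambda>n. g (n - k))"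
  using landau_o.big.compose[OF assms filterlim_minus_const_nat_at_top[of k]] .

text \<open>Substituting \<open>l = k + i\<close> exchanges the order of summation over a triangle.
  It is applied with \<open>h l = a (n - l)\<close>.\<close>

lemma sum_triangle_fps:
  fixes U C :: "real fps"
  shows "(\<Sum>l<R. (U * C) $ l * h l) = (\<Sum>k<R. U $ k * (\<Sum>i<R-k. C $ i * h (k + i)))"
proof -
  have "(\<Sum>l<R. (U * C) $ l * h l) = (\<Sum>l<R. \<Sum>k\<le>l. U $ k * C $ (l - k) * h l)"
    by (simp add: fps_mult_nth sum_distrib_right atLeast0AtMost)
  also have "\<dots> = (\<Sum>(l,k)\<in>(SIGMA l:{..<R}. {..l}). U $ k * C $ (l - k) * h l)"
    by (subst sum.Sigma) auto
  also have "\<dots> = (\<Sum>(k,i)\<in>(SIGMA k:{..<R}. {..<R-k}). U $ k * (C $ i * h (k + i)))"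
    by (rule sum.reindex_bij_witness[where i = "\<lambda>(k,i). (k+i,k)" and j = "\<lambda>(l,k). (k,l-k)"]) auto
  also have "\<dots> = (\<Sum>k<R. U $ k * (\<Sum>i<R-k. C $ i * h (k + i)))"
    by (subst sum.Sigma[symmetric]) (auto simp: sum_distrib_left)
  finally show ?thesis .
qed

text \<open>In the \<open>k\<close>-th term the argument is already shifted by \<open>k\<close>, so
  order \<open>R - k\<close> for \<open>X\<close> suffices for an error of \<open>a (n - R)\<close>.
  Asking for it only where \<open>U $ k\<close> is nonzero lets a series \<open>U\<close> without
  constant term get by with orders below \<open>R\<close>.\<close>

lemma expands_at_convolution:
  assumes "\<And>k. k < R \<Longrightarrow> U $ k \<noteq> 0 \<Longrightarrow> expands_at a (R - k) X C"
  shows "(\<lambda>n. (\<Sum>k<R. U $ k * X $ (n - k)) - (\<Sum>l<R. (U * C) $ l * a (n - l)))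
           \<in> O(\<lambda>n. a (n - R))"
proof -
  have "(\<lambda>n. \<Sum>k<R. U $ k * (X $ (n - k) - (\<Sum>i<R-k. C $ i * a (n - k - i))))
           \<in> O(\<lambda>n. a (n - R))"
  proof (rule big_sum_in_bigo)
    fix k assume "k \<in> {..<R}"
    then have k: "k < R" by simp
    show "(\<lambda>n. U $ k * (X $ (n - k) - (\<Sum>i<R-k. C $ i * a (n - k - i)))) \<in> O(\<lambda>n. a (n - R))"
    proof (cases "U $ k = 0")
      case False
      from bigo_shift_nat[OF assms[OF k False, unfolded expands_at_def], of k] k False
      show ?thesis by simp
    qed simp
  qed
  then show ?thesis
    by (simp add: sum_triangle_fps[where h = "\<lambda>l. a (_ - l)"] right_diff_distrib sum_subtractf)
qed

text \<open>The Cauchy product is cut at \<open>R\<close> and \<open>n - R\<close>: the middle range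
  is dominated by the sum in the definition of \<open>gargantuan\<close>, and
  \<open>k \<mapsto> n - k\<close> reflects the upper range into the second sum.\<close>

lemma convolution_truncate:
  fixes X Y :: "real fps"
  assumes garg: "gargantuan a" and X: "\<And>n. \<bar>X $ n\<bar> \<le> a n" and Y: "\<And>n. \<bar>Y $ n\<bar> \<le> a n"
    and R: "R \<ge> 1"
  shows "(\<lambda>n. (X * Y) $ n - (\<Sum>k<R. X $ k * Y $ (n - k)) - (\<Sum>k<R. Y $ k * X $ (n - k)))
           \<in> O(\<lambda>n. a (n - R))"
proof -
  have a0: "0 \<le> a n" for n using X[of n] by linarith
  have "(\<lambda>n. \<Sum>k=R..n-R. \<bar>a k * a (n - k)\<bar>) \<in> O(\<lambda>n. a (n - R))"
    using garg R by (simp add: gargantuan_def)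
  moreover have "\<forall>\<^sub>F n in sequentially.
    norm ((X * Y) $ n - (\<Sum>k<R. X $ k * Y $ (n - k)) - (\<Sum>k<R. Y $ k * X $ (n - k)))
      \<le> norm (\<Sum>k=R..n-R. \<bar>a k * a (n - k)\<bar>)"
    using eventually_ge_at_top[of "2 * R"]
  proof eventually_elim
    case (elim n)
    \<comment> \<open>From \<open>n = 2 * R\<close> on, the two ends do not overlap.\<close>
    have split: "{0..n} = {..<R} \<union> ({R..n-R} \<union> {n-R<..n})" using elim by auto
    have "(X * Y) $ n = (\<Sum>k<R. X $ k * Y $ (n - k)) + ((\<Sum>k=R..n-R. X $ k * Y $ (n - k))
        + (\<Sum>k\<in>{n-R<..n}. X $ k * Y $ (n - k)))"
      unfolding fps_mult_nth split using elim by (subst sum.union_disjoint, fastforce+)+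
    also have "(\<Sum>k\<in>{n-R<..n}. X $ k * Y $ (n - k)) = (\<Sum>k<R. Y $ k * X $ (n - k))"
      by (rule sum.reindex_bij_witness[where i = "\<lambda>k. n - k" and j = "\<lambda>k. n - k"])
        (use elim in auto)
    finally have "(X * Y) $ n - (\<Sum>k<R. X $ k * Y $ (n - k)) - (\<Sum>k<R. Y $ k * X $ (n - k))
        = (\<Sum>k=R..n-R. X $ k * Y $ (n - k))" by simp
    moreover have "\<bar>\<Sum>k=R..n-R. X $ k * Y $ (n - k)\<bar> \<le> (\<Sum>k=R..n-R. \<bar>a k * a (n - k)\<bar>)"
      by (rule order.trans[OF sum_abs], rule sum_mono)
        (use X Y a0 in \<open>auto simp: abs_mult intro!: mult_mono\<close>)
    ultimately show ?case by simp
  qed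
  ultimately show ?thesis by (rule landau_o.big_trans[OF landau_o.big_mono, rotated])
qed

text \<open>The Leibniz rule. At the lower end \<open>X $ k\<close> is a coefficient and
  \<open>Y $ (n - k)\<close> is expanded, which gives \<open>X * D\<close>; the other end gives
  \<open>Y * C\<close> in the same way.\<close>

lemma expands_at_mult:
  assumes "gargantuan a" "\<And>n. \<bar>X $ n\<bar> \<le> a n" "\<And>n. \<bar>Y $ n\<bar> \<le> a n" "R \<ge> 1"
    and X: "\<And>S. S \<ge> 1 \<Longrightarrow> expands_at a S X C" and Y: "\<And>S. S \<ge> 1 \<Longrightarrow> expands_at a S Y D"
  shows "expands_at a R (X * Y) (X * D + Y * C)"
proof -
  \<comment> \<open>The truncation error plus the errors of expanding the two end sums; the end sums
    cancel.\<close>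
  have "(\<lambda>n. ((X * Y) $ n - (\<Sum>k<R. X $ k * Y $ (n - k)) - (\<Sum>k<R. Y $ k * X $ (n - k)))
     + (((\<Sum>k<R. X $ k * Y $ (n - k)) - (\<Sum>l<R. (X * D) $ l * a (n - l)))
      + ((\<Sum>k<R. Y $ k * X $ (n - k)) - (\<Sum>l<R. (Y * C) $ l * a (n - l)))))
      \<in> O(\<lambda>n. a (n - R))"
    by (intro sum_in_bigo convolution_truncate expands_at_convolution X Y assms(1-4)) auto
  then show ?thesis
    by (simp add: expands_at_def algebra_simps sum.distrib)
qed

text \<open>Truncating \<open>A * B = A - 1\<close> expresses \<open>B $ n\<close> through
  \<open>a (n - k)\<close> and earlier coefficients of \<open>B\<close>, weighted by
  \<open>U = A - 1\<close>. The latter need only lower orders, and \<open>C = (1 - B)^2\<close>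
  satisfies the matching recursion.\<close>

lemma expands_at_SEQ_inverse:
  fixes A B :: "real fps"
  assumes garg: "gargantuan a" and A: "\<And>n. A $ n = a n" and B: "\<And>n. \<bar>B $ n\<bar> \<le> a n"
    and AB: "A * (1 - B) = 1" and A0: "A $ 0 = 1" and "R \<ge> 1"
  shows "expands_at a R B ((1 - B)^2)"
  using \<open>R \<ge> 1\<close>
proof (induction R rule: less_induct)
  case (less R)
  define U where "U = A - 1"
  define C where "C = (1 - B)^2"
  have U_nth: "U $ k = (if k = 0 then 0 else a k)" for k by (simp add: U_def A A0 flip: A)
  have prod: "A * B = A - 1" using AB by (simp add: algebra_simps)
  have "A * C = 1 - B" using AB by (simp add: C_def power2_eq_square flip: mult.assoc)
  \<comment> \<open>The recursion for the coefficients of the expansion, obtained from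
    \<open>(1 + U) * C = 1 - B\<close>.\<close>
  then have C: "C = 1 - B - U * C" by (simp add: U_def algebra_simps)
  have "\<bar>A $ n\<bar> \<le> a n" for n using A B[of n] by simp
  then have 1: "(\<lambda>n. (A * B) $ n - (\<Sum>k<R. A $ k * B $ (n - k)) - (\<Sum>k<R. B $ k * A $ (n - k)))
      \<in> O(\<lambda>n. a (n - R))"
    using garg B less.prems by (intro convolution_truncate) auto
  have 2: "(\<lambda>n. (\<Sum>k<R. U $ k * B $ (n - k)) - (\<Sum>l<R. (U * C) $ l * a (n - l)))
           \<in> O(\<lambda>n. a (n - R))"
  proof (rule expands_at_convolution)
    \<comment> \<open>Since \<open>U $ 0 = 0\<close>, here \<open>k \<ge> 1\<close>, so the order
      \<open>R - k\<close> is below \<open>R\<close> and still positive.\<close>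
    fix k assume "k < R" "U $ k \<noteq> 0"
    then show "expands_at a (R - k) B C"
      unfolding C_def by (intro less.IH) (auto simp: U_nth split: if_splits)
  qed
  have "B $ n - (\<Sum>k<R. C $ k * a (n - k)) =
      - (((A * B) $ n - (\<Sum>k<R. A $ k * B $ (n - k)) - (\<Sum>k<R. B $ k * A $ (n - k)))
      + ((\<Sum>k<R. U $ k * B $ (n - k)) - (\<Sum>l<R. (U * C) $ l * a (n - l))))"
    if "n \<ge> 1" for n
  proof -
    have 3: "(\<Sum>k<R. h k) = h 0 + (\<Sum>k\<in>{..<R}-{0}. h k)" for h :: "nat \<Rightarrow> real"
      using less.prems by (subst sum.remove[of _ 0]) auto
    have "(\<Sum>k<R. A $ k * B $ (n - k)) = B $ n + (\<Sum>k<R. U $ k * B $ (n - k))"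
      by (simp add: 3 U_nth A A0 flip: A cong: sum.cong_simp)
    moreover have "(\<Sum>k<R. C $ k * a (n - k)) =
        (\<Sum>k<R. (1 - B - U * C) $ k * a (n - k))" using C by simp
    moreover have "\<dots> = (\<Sum>k<R. (1 :: real fps) $ k * a (n - k)) - (\<Sum>k<R. B $ k * a (n - k))
        - (\<Sum>l<R. (U * C) $ l * a (n - l))"
      by (simp add: algebra_simps sum_subtractf sum.distrib)
    moreover have "(\<Sum>k<R. (1 :: real fps) $ k * a (n - k)) = a n"
      by (simp add: 3)
    \<comment> \<open>This fails at \<open>n = 0\<close>, where the left side is 0 and
      \<open>a 0 = 1\<close>; hence the restriction on \<open>n\<close>.\<close>
    moreover have "(A * B) $ n = a n" using that by (simp add: prod A)
    ultimately show ?thesis by (simp add: A)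
  qed
  then have ev: "\<forall>\<^sub>F n in sequentially. B $ n - (\<Sum>k<R. C $ k * a (n - k)) =
      - (((A * B) $ n - (\<Sum>k<R. A $ k * B $ (n - k)) - (\<Sum>k<R. B $ k * A $ (n - k)))
      + ((\<Sum>k<R. U $ k * B $ (n - k)) - (\<Sum>l<R. (U * C) $ l * a (n - l))))"
    using eventually_ge_at_top[of 1] by (rule eventually_mono[rotated])
  show ?case
    unfolding expands_at_def C_def[symmetric] landau_o.big.in_cong[OF ev]
    using sum_in_bigo(1)[OF 1 2] by (simp only: landau_o.big.uminus_in_iff)
qed

text \<open>Induction on \<open>m\<close> by the Leibniz rule for \<open>B ^ m * B\<close>, starting
  from the expansion of \<open>B\<close>; the uniform bound \<open>Bm\<close> makes the rule
  applicable at every step.\<close>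

lemma expands_at_power:
  fixes B :: "real fps"
  assumes garg: "gargantuan a" and A: "\<And>n. A $ n = a n"
    and Bm: "\<And>m n. \<bar>(B ^ m) $ n\<bar> \<le> a n"
    and AB: "A * (1 - B) = 1" and A0: "A $ 0 = 1" and "m \<ge> 1" and "R \<ge> 1"
  shows "expands_at a R (B ^ m) (of_nat m * B ^ (m - 1) * (1 - B)^2)"
  using \<open>m \<ge> 1\<close> \<open>R \<ge> 1\<close>
proof (induction m arbitrary: R rule: dec_induct)
  case base
  then show ?case
    using expands_at_SEQ_inverse[OF garg A _ AB A0, of R] Bm[of 1] by simp
next
  case (step m)
  have B: "expands_at a S B ((1 - B)^2)" if "S \<ge> 1" for S
    using expands_at_SEQ_inverse[OF garg A _ AB A0 that] Bm[of 1] by simp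
  have "expands_at a R (B ^ m * B) (B ^ m * (1 - B)^2 + B * (of_nat m * B ^ (m - 1) * (1 - B)^2))"
    using Bm[of 1] by (intro expands_at_mult garg Bm step B) auto
  also have "B * (of_nat m * B ^ (m - 1) * (1 - B)^2) = of_nat m * B ^ m * (1 - B)^2"
    using step.hyps by (cases m) (auto simp: algebra_simps)
  finally show ?case by (simp add: algebra_simps)
qed

section \<open>Counting sequences\<close>

definition egf :: "'a lclass \<Rightarrow> real fps" where
  "egf C = Abs_fps (\<lambda>n. real (num_objs C n) / fact n)"

text \<open>Sequences with an arbitrary label set \<open>L\<close>: after removing the first component the labels no
  longer form an initial segment, and this generality makes it unnecessary to relabel the rest.\<close>

definition labeled_seqs :: "'b lclass \<Rightarrow> nat \<Rightarrow> nat set \<Rightarrow> (nat set \<times> 'b) list set" where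
  "labeled_seqs B m L = {xs. length xs = m \<and>
     (\<forall>(S, b)\<in>set xs. b \<in> objs B \<and> finite S \<and> card S = osize B b) \<and>
     (\<forall>i<length xs. \<forall>j<length xs. i \<noteq> j \<longrightarrow> fst (xs ! i) \<inter> fst (xs ! j) = {}) \<and>
     (\<Union>(S, b)\<in>set xs. S) = L}"

lemma labeled_seqs_0: "labeled_seqs B 0 L = (if L = {} then {[]} else {})"
  by (auto simp: labeled_seqs_def)

text \<open>Puts the disjointness by indices into a recursive form for inductions that peel off the
  first component.\<close>

lemma pairwise_nth_Cons:
  "(\<forall>i<length (x # xs). \<forall>j<length (x # xs). i \<noteq> j \<longrightarrow> fst ((x # xs) ! i) \<inter> fst ((x # xs) ! j) = {})
   \<longleftrightarrow> (\<forall>y\<in>set xs. fst x \<inter> fst y = {}) \<and>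
     (\<forall>i<length xs. \<forall>j<length xs. i \<noteq> j \<longrightarrow> fst (xs ! i) \<inter> fst (xs ! j) = {})"
  by (simp add: All_less_Suc2 all_set_conv_all_nth) blast

text \<open>The label set of the first component fixes its size, so it is chosen first; what remains
  is a shorter sequence on the complement.\<close>

lemma labeled_seqs_Suc:
  assumes "finite L"
  shows "labeled_seqs B (Suc m) L =
    (\<lambda>(S, b, xs). (S, b) # xs) `
      (SIGMA S:Pow L. objs_of_size B (card S) \<times> labeled_seqs B m (L - S))" (is "?l = ?r")
proof (intro set_eqI iffI)
  fix ys assume ys: "ys \<in> ?l"
  then obtain S b xs where eq: "ys = (S, b) # xs" "length xs = m"
    by (auto simp: labeled_seqs_def length_Suc_conv)
  have "(S, b, xs) \<in> (SIGMA S:Pow L. objs_of_size B (card S) \<times> labeled_seqs B m (L - S))"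
    using ys unfolding labeled_seqs_def eq mem_Collect_eq pairwise_nth_Cons
    by (auto simp: eq objs_of_size_def) fastforce+
  then have "(\<lambda>(S, b, xs). (S, b) # xs) (S, b, xs) \<in> ?r" by (rule imageI)
  then show "ys \<in> ?r" by (simp only: eq prod.case)
next
  fix ys assume "ys \<in> ?r"
  then obtain S b xs where eq: "ys = (S, b) # xs" and *: "S \<subseteq> L" "b \<in> objs_of_size B (card S)"
    "xs \<in> labeled_seqs B m (L - S)" by auto
  show "ys \<in> ?l"
    using * finite_subset[OF *(1) assms]
    unfolding labeled_seqs_def eq mem_Collect_eq pairwise_nth_Cons
    by (auto simp: objs_of_size_def) fastforce
qed

text \<open>Grouping the first label set by its size \<open>k\<close> gives a binomial coefficient,
  which together with the factorials of both parts makes \<open>fact (card L)\<close> and leaves a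
  Cauchy product. Finiteness is carried along because counting the dependent sum requires
  it.\<close>

lemma card_labeled_seqs:
  assumes "labeled_class B" "finite L"
  shows "finite (labeled_seqs B m L) \<and>
    real (card (labeled_seqs B m L)) = fact (card L) * (egf B ^ m) $ card L"
  using \<open>finite L\<close>
proof (induction m arbitrary: L)
  case 0
  then show ?case by (auto simp: labeled_seqs_0)
next
  case (Suc m)
  interpret labeled_class B by fact
  let ?D = "SIGMA S:Pow L. objs_of_size B (card S) \<times> labeled_seqs B m (L - S)"
  have fin: "finite ?D" using Suc finite_objs_of_size by auto
  have inj: "inj_on (\<lambda>(S, b, xs). (S, b) # xs) ?D" by (auto simp: inj_on_def)
  have "real (card (labeled_seqs B (Suc m) L)) = real (card ?D)"
    by (simp add: labeled_seqs_Suc[OF Suc.prems] card_image[OF inj])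
  also have "\<dots> = (\<Sum>S\<in>Pow L. real (num_objs B (card S)) * real (card (labeled_seqs B m (L - S))))"
    using Suc finite_objs_of_size by (subst card_SigmaI) (auto simp: card_cartesian_product num_objs_def)
  also have "\<dots> = (\<Sum>S\<in>Pow L. fact (card S) * egf B $ card S *
      (fact (card L - card S) * (egf B ^ m) $ (card L - card S)))"
    using Suc by (intro sum.cong) (auto simp: egf_def card_Diff_subset finite_subset)
  \<comment> \<open>The summand depends on \<open>S\<close> only through its cardinality.\<close>
  also have "\<dots> = (\<Sum>k\<le>card L. \<Sum>S | S \<in> Pow L \<and> card S = k. fact (card S) * egf B $ card S *
      (fact (card L - card S) * (egf B ^ m) $ (card L - card S)))"
    using Suc.prems by (intro sum.group[symmetric]) (auto intro: card_mono)
  also have "\<dots> = (\<Sum>k\<le>card L. real (card L choose k) * (fact k * egf B $ k *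
      (fact (card L - k) * (egf B ^ m) $ (card L - k))))"
    using n_subsets[OF Suc.prems] by (intro sum.cong) auto
  also have "\<dots> = (\<Sum>k\<le>card L. fact (card L) * (egf B $ k * (egf B ^ m) $ (card L - k)))"
    by (intro sum.cong) (auto simp: binomial_fact)
  also have "\<dots> = fact (card L) * (egf B ^ Suc m) $ card L"
    by (simp add: fps_mult_nth atLeast0AtMost sum_distrib_left)
  finally show ?case using fin by (simp add: labeled_seqs_Suc[OF Suc.prems])
qed

text \<open>\<open>labeled_seqs\<close> does not mention the total size, but disjointness makes it
  the cardinality of the union of the label sets, so the union \<open>{1..n}\<close> forces size
  \<open>n\<close>.\<close>

lemma objs_of_size_SEQ_pow: "objs_of_size (SEQ_pow m B) n = labeled_seqs B m {1..n}"
proof -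
  have *: "card (\<Union>(S, b)\<in>set xs. S) = seq_size B xs"
    if "\<forall>(S, b)\<in>set xs. b \<in> objs B \<and> finite S \<and> card S = osize B b"
      "\<forall>i<length xs. \<forall>j<length xs. i \<noteq> j \<longrightarrow> fst (xs ! i) \<inter> fst (xs ! j) = {}" for xs
    using that
  proof (induction xs)
    case (Cons x xs)
    have "card (fst x \<union> (\<Union>(S, b)\<in>set xs. S)) = card (fst x) + card (\<Union>(S, b)\<in>set xs. S)"
      using Cons.prems unfolding pairwise_nth_Cons by (intro card_Un_disjoint) fastforce+
    then show ?case using Cons unfolding pairwise_nth_Cons
      by (auto simp: seq_size_def case_prod_unfold)
  qed (simp add: seq_size_def)
  have "seq_size B xs = n" if "xs \<in> labeled_seqs B m {1..n}" for xs
    using that *[of xs] by (auto simp: labeled_seqs_def)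
  then show ?thesis
    by (auto simp: objs_of_size_def SEQ_pow_def seq_objs_def labeled_seqs_def)
qed

lemma egf_SEQ_pow:
  assumes "labeled_class B"
  shows "egf (SEQ_pow m B) = egf B ^ m"
  using card_labeled_seqs[OF assms, of "{1.._}" m]
  by (intro fps_ext) (simp add: egf_def[of "SEQ_pow m B"] num_objs_def objs_of_size_SEQ_pow)

lemma num_objs_SEQ_pow:
  assumes "labeled_class B"
  shows "real (num_objs (SEQ_pow m B) n) = fact n * (egf B ^ m) $ n"
  unfolding egf_SEQ_pow[OF assms, symmetric] by (simp add: egf_def)

section \<open>The generating function of the class of all sequences\<close>

lemma objs_of_size_SEQ: "objs_of_size (SEQ B) n = (\<Union>m. objs_of_size (SEQ_pow m B) n)"
  by (auto simp: objs_of_size_def SEQ_def SEQ_pow_def)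

text \<open>As \<open>B\<close> has no object of size 0, more than \<open>n\<close> components
  cannot have total size \<open>n\<close>, and the union over all \<open>m\<close> becomes finite.
  The free bound \<open>N\<close> allows one cutoff for several coefficients.\<close>

lemma egf_SEQ_nth:
  assumes "labeled_class B" "num_objs B 0 = 0" "n \<le> N"
  shows "egf (SEQ B) $ n = (\<Sum>m\<le>N. (egf B ^ m) $ n)"
proof -
  interpret S: labeled_class "SEQ B" using assms by (intro labeled_class_SEQ)
  have sub: "objs_of_size (SEQ_pow m B) n \<subseteq> objs_of_size (SEQ B) n" for m
    by (auto simp: objs_of_size_SEQ)
  have fin: "finite (objs_of_size (SEQ_pow m B) n)" for m
    using sub S.finite_objs_of_size finite_subset by blast
  have "objs_of_size (SEQ_pow m B) n = {}" if "m > n" for m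
  proof -
    have "(egf B ^ m) $ n = 0"
      using startsby_zero_power_prefix[of "egf B" m] assms that by (auto simp: egf_def)
    then have "num_objs (SEQ_pow m B) n = 0"
      using num_objs_SEQ_pow[OF assms(1), of m n] by simp
    \<comment> \<open>A count of 0 means emptiness only for a finite set.\<close>
    then show ?thesis using fin by (simp add: num_objs_def)
  qed
  then have "objs_of_size (SEQ_pow m B) n = {}" if "\<not> m \<le> N" for m using that assms(3) by simp
  then have "objs_of_size (SEQ B) n = (\<Union>m\<le>N. objs_of_size (SEQ_pow m B) n)"
    unfolding objs_of_size_SEQ by blast
  then have "num_objs (SEQ B) n = (\<Sum>m\<le>N. num_objs (SEQ_pow m B) n)"
    unfolding num_objs_def
    by (simp only:, intro card_UN_disjoint) (auto simp: fin, auto simp: objs_of_size_def SEQ_pow_def)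
  then show ?thesis
    by (simp add: egf_def[of "SEQ B"] num_objs_SEQ_pow[OF assms(1)] flip: sum_distrib_left)
qed

text \<open>Up to degree \<open>n\<close> only the powers \<open>m \<le> n\<close> count; their
  geometric sum telescopes to \<open>1 - egf B ^ Suc n\<close>, which agrees with 1 up to that
  degree.\<close>

lemma egf_SEQ:
  assumes "labeled_class B" "num_objs B 0 = 0"
  shows "egf (SEQ B) * (1 - egf B) = 1"
proof (rule fps_ext)
  fix n
  have "(egf (SEQ B) * (1 - egf B)) $ n = ((\<Sum>m\<le>n. egf B ^ m) * (1 - egf B)) $ n"
    by (simp add: fps_mult_nth fps_sum_nth egf_SEQ_nth[OF assms] del: fps_sub_nth)
  also have "(\<Sum>m\<le>n. egf B ^ m) * (1 - egf B) = 1 - egf B ^ Suc n"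
    using one_diff_power_eq[of "egf B" "Suc n"] by (simp only: lessThan_Suc_atMost mult.commute)
  also have "\<dots> $ n = 1 $ n"
    using startsby_zero_power_prefix[of "egf B" "Suc n"] assms by (auto simp: egf_def)
  finally show "(egf (SEQ B) * (1 - egf B)) $ n = 1 $ n" .
qed

lemma egf_power_nonneg: "labeled_class B \<Longrightarrow> 0 \<le> (egf B ^ m) $ n"
  by (simp flip: egf_SEQ_pow) (simp add: egf_def)

text \<open>A single term of a nonnegative sum; the cutoff \<open>max m n\<close> ensures that the
  term for \<open>m\<close> occurs in it.\<close>

lemma egf_power_le_SEQ:
  assumes "labeled_class B" "num_objs B 0 = 0"
  shows "(egf B ^ m) $ n \<le> egf (SEQ B) $ n"
  unfolding egf_SEQ_nth[OF assms, of n "max m n", simplified]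
  by (rule member_le_sum) (auto simp: egf_power_nonneg[OF assms(1)])

section \<open>Transfer of counts and probabilities along the isomorphism\<close>

lemma num_objs_iso:
  assumes "lclass_iso \<phi> C D"
  shows "card {a \<in> objs_of_size C n. \<phi> a \<in> X} = card (objs_of_size D n \<inter> X)"
proof (rule bij_betw_same_card)
  show "bij_betw \<phi> {a \<in> objs_of_size C n. \<phi> a \<in> X} (objs_of_size D n \<inter> X)"
    using assms unfolding lclass_iso_def bij_betw_def objs_of_size_def
    by (fastforce intro: inj_on_subset)
qed

lemma egf_iso: "lclass_iso \<phi> C D \<Longrightarrow> egf C = egf D"
  using num_objs_iso[of \<phi> C D _ UNIV] by (simp add: egf_def num_objs_def)

text \<open>A quotient of counts in which \<open>fact n\<close> cancels. Positivity excludes the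
  empty set, where the uniform distribution is unspecified.\<close>

lemma prob_SEQ_components:
  assumes "labeled_class A" "labeled_class B" "lclass_iso \<phi> A (SEQ B)" "num_objs A n > 0"
  shows "prob_of_size A n (has_SEQ_components \<phi> B m) = (egf B ^ m) $ n / egf A $ n"
proof -
  interpret labeled_class A by fact
  have "objs_of_size A n \<noteq> {}" using assms(4) by (auto simp: num_objs_def)
  then have "prob_of_size A n (has_SEQ_components \<phi> B m) =
      real (card (objs_of_size A n \<inter> {a. has_SEQ_components \<phi> B m a})) / real (num_objs A n)"
    unfolding prob_of_size_def num_objs_def
    by (rule measure_pmf_of_set) (rule finite_objs_of_size)
  also have "objs_of_size A n \<inter> {a. has_SEQ_components \<phi> B m a} =
      {a \<in> objs_of_size A n. \<phi> a \<in> objs (SEQ_pow m B)}"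
    by (auto simp: has_SEQ_components_def)
  also have "card \<dots> = card (objs_of_size (SEQ B) n \<inter> objs (SEQ_pow m B))"
    by (rule num_objs_iso[OF assms(3)])
  also have "objs_of_size (SEQ B) n \<inter> objs (SEQ_pow m B) = objs_of_size (SEQ_pow m B) n"
    by (auto simp: objs_of_size_def SEQ_def SEQ_pow_def)
  finally show ?thesis
    by (simp add: num_objs_SEQ_pow[OF assms(2)] flip: num_objs_def) (simp add: egf_def[of A])
qed

section \<open>The expansion of the probabilities\<close>

text \<open>The limit condition on consecutive terms, shifted by \<open>k\<close>; it yields the
  second half of \<open>asymp_expansion\<close>.\<close>

lemma gargantuan_ratio_smallo:
  assumes "gargantuan a"
  shows "(\<lambda>n. a (n - Suc k) / a n) \<in> o(\<lambda>n. a (n - k) / a n)"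
proof -
  have ne: "\<forall>\<^sub>F n in sequentially. a n \<noteq> 0" and lim: "(\<lambda>n. a (n - 1) / a n) \<longlonglongrightarrow> 0"
    using assms by (auto simp: gargantuan_def)
  have "(\<lambda>n. a (n - 1)) \<in> o(a)" using lim ne by (intro smalloI_tendsto)
  from landau_o.small.compose[OF this filterlim_minus_const_nat_at_top[of k]]
  have "(\<lambda>n. a (n - Suc k)) \<in> o(\<lambda>n. a (n - k))" by simp
  then show ?thesis using landau_o.small.divide_right[OF ne] by blast
qed

text \<open>The expansion of \<open>egf B ^ m\<close> is divided by \<open>a n\<close>. The factor
  \<open>1 / fact k\<close> hidden in the binomial scale turns the coefficient \<open>C $ k\<close>
  into \<open>fact k * C $ k\<close>.\<close>

lemma asymp_expansion_SEQ_components: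
  fixes A :: "'a lclass" and B :: "'b lclass"
  assumes A: "labeled_class A" and B: "labeled_class B" and B0: "num_objs B 0 = 0"
    and iso: "lclass_iso \<phi> A (SEQ B)" and garg: "gargantuan_class A" and m: "m \<ge> 1"
  shows "asymp_expansion
            (\<lambda>n. prob_of_size A n (has_SEQ_components \<phi> B m)) 0
            (\<lambda>k. real m * (real (num_objs (SEQ_pow (m - 1) B) k)
                   - 2 * real (num_objs (SEQ_pow m B) k)
                   + real (num_objs (SEQ_pow (m + 1) B) k)))
            (\<lambda>k n. real (n choose k) * real (num_objs A (n - k)) / real (num_objs A n))"
    (is "asymp_expansion ?p 0 ?d ?f")
proof -
  define a where "a = (\<lambda>n. egf A $ n)"
  define C where "C = of_nat m * egf B ^ (m - 1) * (1 - egf B)^2"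
  have ga: "gargantuan a" using garg by (simp add: gargantuan_class_def a_def egf_def)
  then have ne: "\<forall>\<^sub>F n in sequentially. a n \<noteq> 0" by (simp add: gargantuan_def)
  have Am: "egf A * (1 - egf B) = 1" using egf_SEQ[OF B B0] egf_iso[OF iso] by simp
  have A0: "egf A $ 0 = 1"
    using arg_cong[OF Am, of "\<lambda>F. F $ 0"] B0 by (simp add: egf_def[of B])
  \<comment> \<open>For \<open>n < k\<close> the binomial vanishes while \<open>n - k\<close>
    truncates to 0, so the identity holds only eventually.\<close>
  have f: "\<forall>\<^sub>F n in sequentially. ?f k n = inverse (fact k) * (a (n - k) / a n)" for k
    using eventually_ge_at_top[of k]
    by eventually_elim (simp add: a_def egf_def binomial_fact divide_simps)
  have C': "C = of_nat m * (egf B ^ (m - 1) - 2 * egf B ^ m + egf B ^ (m + 1))"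
    using m by (cases m) (auto simp: C_def algebra_simps power2_eq_square)
  have nonzero: "inverse (fact k) \<noteq> (0 :: real)" for k :: nat by simp
  have d: "?d k = fact k * C $ k" for k
    unfolding num_objs_SEQ_pow[OF B] C' fps_mult_of_nat_nth
    by (simp add: algebra_simps numeral_fps_const fps_of_nat[symmetric])
  have exp: "expands_at a R (egf B ^ m) C" if "R \<ge> 1" for R
    unfolding C_def
  proof (rule expands_at_power[OF ga _ _ Am A0 m that])
    show "\<bar>(egf B ^ k) $ n\<bar> \<le> a n" for k n
      using egf_power_nonneg[OF B] egf_power_le_SEQ[OF B B0] egf_iso[OF iso]
      by (simp add: a_def)
  qed (simp add: a_def)
  show ?thesis unfolding asymp_expansion_def
  proof (intro conjI allI impI)
    fix r :: nat
    \<comment> \<open>Summing up to \<open>r\<close> inclusive is order \<open>r + 1\<close> of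
      \<open>expands_at\<close>.\<close>
    have "(\<lambda>n. ((egf B ^ m) $ n - (\<Sum>k<r+1. C $ k * a (n - k))) / a n)
        \<in> O(\<lambda>n. a (n - (r + 1)) / a n)"
      using exp[of "r + 1"] unfolding expands_at_def
      by (intro landau_o.big.divide_right[OF ne]) auto
    also have "(\<lambda>n. a (n - (r + 1)) / a n) \<in> O(?f (r + 1))"
      unfolding landau_o.big.cong[OF f] landau_o.big.cmult[OF nonzero] by (rule landau_o.big_refl)
    finally have "(\<lambda>n. ((egf B ^ m) $ n - (\<Sum>k<r+1. C $ k * a (n - k))) / a n) \<in> O(?f (r + 1))" .
    moreover have "\<forall>\<^sub>F n in sequentially. ?p n - (\<Sum>k=0..r. ?d k * ?f k n) =
        ((egf B ^ m) $ n - (\<Sum>k<r+1. C $ k * a (n - k))) / a n"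
      using ne eventually_ge_at_top[of r]
    proof eventually_elim
      case (elim n)
      have pos: "num_objs A n > 0" using elim by (auto simp: a_def egf_def intro: gr0I)
      have "?d k * ?f k n = C $ k * a (n - k) / a n" if "k \<le> r" for k
        unfolding d using that elim by (simp add: a_def egf_def binomial_fact)
      then have "(\<Sum>k=0..r. ?d k * ?f k n) = (\<Sum>k=0..r. C $ k * a (n - k) / a n)"
        by (intro sum.cong) auto
      also have "\<dots> = (\<Sum>k<r+1. C $ k * a (n - k)) / a n"
        by (simp add: sum_divide_distrib atLeast0AtMost lessThan_Suc_atMost)
      finally show ?case
        by (simp add: prob_SEQ_components[OF A B iso pos] diff_divide_distrib a_def)
    qed
    ultimately show "(\<lambda>n. ?p n - (\<Sum>k=0..r. ?d k * ?f k n)) \<in> O(?f (r + 1))"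
      by (rule landau_o.big.in_cong[THEN iffD2, rotated])
  next
    fix k :: nat
    have "(\<lambda>n. inverse (fact (k+1)) * (a (n - (k+1)) / a n))
        \<in> o(\<lambda>n. inverse (fact k) * (a (n - k) / a n))"
      unfolding landau_o.small.cmult[OF nonzero] landau_o.small.cmult_in_iff[OF nonzero]
      using gargantuan_ratio_smallo[OF ga, of k] by simp
    then show "?f (k + 1) \<in> o(?f k)"
      by (rule landau_o.small.cong_ex[OF f f, THEN iffD2])
  qed
qed

text \<open>The irreducible case is \<open>m = 1\<close> with the term \<open>k = 0\<close>,
  eventually equal to 1, moved to the left; this is why its sum starts at 1.\<close>

theorem theorem3p1:
  fixes A :: "'a lclass" and B :: "'b lclass" and \<phi> :: "'a \<Rightarrow> (nat set \<times> 'b) list"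
  assumes "labeled_class A" and "labeled_class B" and "num_objs B 0 = 0"
    and "lclass_iso \<phi> A (SEQ B)"
    and "gargantuan_class A"
  shows "(\<forall>m\<ge>1. asymp_expansion
            (\<lambda>n. prob_of_size A n (has_SEQ_components \<phi> B m)) 0
            (\<lambda>k. real m * (real (num_objs (SEQ_pow (m - 1) B) k)
                   - 2 * real (num_objs (SEQ_pow m B) k)
                   + real (num_objs (SEQ_pow (m + 1) B) k)))
            (\<lambda>k n. real (n choose k) * real (num_objs A (n - k)) / real (num_objs A n)))
       \<and> asymp_expansion
            (\<lambda>n. prob_of_size A n (SEQ_irreducible \<phi> B) - 1) 1
            (\<lambda>k. - (2 * real (num_objs B k) - real (num_objs (SEQ_pow 2 B) k)))
            (\<lambda>k n. real (n choose k) * real (num_objs A (n - k)) / real (num_objs A n))"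
    (is "?general \<and> asymp_expansion ?p 1 ?c ?f")
proof
  show general: ?general using asymp_expansion_SEQ_components[OF assms] by blast
  let ?d = "\<lambda>k. real 1 * (real (num_objs (SEQ_pow (1 - 1) B) k)
                   - 2 * real (num_objs (SEQ_pow 1 B) k)
                   + real (num_objs (SEQ_pow (1 + 1) B) k))"
  have e: "asymp_expansion (\<lambda>n. prob_of_size A n (has_SEQ_components \<phi> B 1)) 0 ?d ?f"
    using general by blast
  have pow1: "real (num_objs (SEQ_pow 1 B) k) = real (num_objs B k)" for k
    using num_objs_SEQ_pow[OF assms(2), of 1 k] by (simp add: egf_def)
  have pow0: "real (num_objs (SEQ_pow 0 B) k) = (if k = 0 then 1 else 0)" for k
    using num_objs_SEQ_pow[OF assms(2), of 0 k] by simp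
  have "egf B $ 0 = 0" using assms(3) by (simp add: egf_def)
  then have "num_objs (SEQ_pow 2 B) 0 = 0"
    using num_objs_SEQ_pow[OF assms(2), of 2 0] by (simp add: power2_eq_square)
  then have d0: "?d 0 = 1" using assms(3) pow1[of 0] by (simp add: pow0 pow1 numeral_2_eq_2)
  \<comment> \<open>For \<open>k \<ge> 1\<close> the empty sequence no longer contributes to
    \<open>?d k\<close>.\<close>
  have d: "?d k = ?c k" if "k \<ge> 1" for k
    using that pow1[of k] by (simp add: pow0 numeral_2_eq_2)
  \<comment> \<open>Needed for \<open>?f 0 n = 1\<close>, a quotient of equal counts.\<close>
  have ne: "\<forall>\<^sub>F n in sequentially. num_objs A n \<noteq> 0"
    using assms(5) by (auto simp: gargantuan_class_def gargantuan_def elim: eventually_mono)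
  show "asymp_expansion ?p 1 ?c ?f"
    unfolding asymp_expansion_def
  proof (intro conjI allI impI)
    fix r :: nat
    have "\<forall>\<^sub>F n in sequentially. ?p n - (\<Sum>k=1..r. ?c k * ?f k n) =
        prob_of_size A n (has_SEQ_components \<phi> B 1) - (\<Sum>k=0..r. ?d k * ?f k n)"
      using ne
    proof eventually_elim
      case (elim n)
      have "(\<Sum>k=0..r. ?d k * ?f k n) = ?d 0 * ?f 0 n + (\<Sum>k=1..r. ?d k * ?f k n)"
        by (simp only: sum.atLeast_Suc_atMost[of 0 r] le0 One_nat_def)
      also have "\<dots> = 1 + (\<Sum>k=1..r. ?c k * ?f k n)"
        unfolding d0 using elim d by (intro arg_cong2[where f = "(+)"] sum.cong) auto
      finally show ?case unfolding SEQ_irreducible_def[abs_def] by simp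
    qed
    moreover have "(\<lambda>n. prob_of_size A n (has_SEQ_components \<phi> B 1) - (\<Sum>k=0..r. ?d k * ?f k n))
        \<in> O(?f (r + 1))"
      using e unfolding asymp_expansion_def by blast
    ultimately show "(\<lambda>n. ?p n - (\<Sum>k=1..r. ?c k * ?f k n)) \<in> O(?f (r + 1))"
      by (rule landau_o.big.in_cong[THEN iffD2])
  next
    fix k :: nat
    show "?f (k + 1) \<in> o(?f k)" using e unfolding asymp_expansion_def by blast
  qed
qed

end
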